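(* Let $\mathcal{J}\subset\mathbb{R}\setminus\{0\}$ be a finite set, let $\lambda_j>0$ for $j\in\mathcal{J}$, and let $\{\mathcal{S}(s,t),\ (s,t)\in\mathbb{R}^2_+\}$ be the two-parameter generalized Skellam random field with parameters $\{\lambda_j\}_{j\in\mathcal{J}}$. Then for all $(s,t)\in\mathbb{R}^2_+$ and $\xi\in\mathbb{R}$, $$\mathbb{E}\exp\bigg(i\xi\int_{0}^{s}\int_{0}^{t}\mathcal{S}(x,y)\,\mathrm{d}y\,\mathrm{d}x\bigg)=\exp\bigg(\sum_{j\in\mathcal{J}}\lambda_j st\int_{0}^{1}\int_{0}^{1}\big(e^{ij\xi stxy}-1\big)\,\mathrm{d}x\,\mathrm{d}y\bigg),$$ where on the left $x$ ranges over $[0,s]$ and $y$ over $[0,t]$.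
   Context: $\mathbb{R}_+$ is the set of non-negative reals and $i$ is the imaginary unit. A Poisson random field (PRF) on $\mathbb{R}^2_+$ with parameter $\lambda>0$ is a non-negative integer-valued random measure $\{N(B)\}$ indexed by Borel sets $B\subseteq\mathbb{R}^2_+$ such that $N(B)$ is Poisson with mean $\lambda|B|$ whenever the Lebesgue measure $|B|$ is finite, and $N(B_1),\dots,N(B_n)$ are independent for disjoint $B_1,\dots,B_n$. One writes $N(s,t)=N([0,s]\times[0,t])$. The two-parameter generalized Skellam random field with parameters $\{\lambda_j\}_{j\in\mathcal{J}}$ is $\mathcal{S}(s,t)=\sum_{j\in\mathcal{J}}jN_j(s,t)$, where $\{N_j(s,t),\ (s,t)\in\mathbb{R}^2_+\}$, $j\in\mathcal{J}$, are independent PRFs with parameters $\lambda_j$ respectively. *)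

theory Defs
  imports "HOL-Probability.Probability"
begin

definition quadrant :: "(real \<times> real) set" where
  "quadrant = {0..} \<times> {0..}"

(* The random measure is a map N into measures on the Borel sets of the quadrant; N \<omega> need not be
   a finite measure, so its values are ennreal.  "Non-negative integer-valued" is the usual notion
   of an integer-valued random measure: N \<omega> B is a natural number for every bounded Borel set B
   (so N \<omega> is locally finite), and N \<omega> B may be \<infinity> for unbounded B.  The Poisson law is spelled
   out through its probability mass function because the mean may be 0, where 0 ^ 0 = 1
   gives the point mass at 0 (poisson_pmf is only specified for a positive rate). *)
locale poisson_random_field = prob_space M
  for M :: "'w measure"
    and N :: "'w \<Rightarrow> (real \<times> real) measure"
    and rate :: real +
  assumes rate_pos: "0 < rate"
    and sets_N: "\<And>\<omega>. \<omega> \<in> space M \<Longrightarrow> sets (N \<omega>) = sets (restrict_space borel quadrant)"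
    and measurable_N: "\<And>B. B \<in> sets borel \<Longrightarrow> B \<subseteq> quadrant \<Longrightarrow>
          random_variable borel (\<lambda>\<omega>. emeasure (N \<omega>) B)"
    and integer_valued: "\<And>\<omega> B. \<omega> \<in> space M \<Longrightarrow> B \<in> sets borel \<Longrightarrow> B \<subseteq> quadrant \<Longrightarrow> bounded B \<Longrightarrow>
          \<exists>n::nat. emeasure (N \<omega>) B = of_nat n"
    and poisson_N: "\<And>B n. B \<in> sets borel \<Longrightarrow> B \<subseteq> quadrant \<Longrightarrow> emeasure lborel B < \<infinity> \<Longrightarrow>
          prob {\<omega> \<in> space M. emeasure (N \<omega>) B = of_nat n} =
            exp (- (rate * measure lborel B)) * (rate * measure lborel B) ^ n / fact n"
    and indep_N: "\<And>(B :: nat \<Rightarrow> (real \<times> real) set) n.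
          (\<And>i. i < n \<Longrightarrow> B i \<in> sets borel \<and> B i \<subseteq> quadrant) \<Longrightarrow> disjoint_family_on B {..<n} \<Longrightarrow>
          indep_vars (\<lambda>_. borel) (\<lambda>i \<omega>. emeasure (N \<omega>) (B i)) {..<n}"

definition prf_at :: "('w \<Rightarrow> (real \<times> real) measure) \<Rightarrow> real \<Rightarrow> real \<Rightarrow> 'w \<Rightarrow> real" where
  "prf_at N s t \<omega> = measure (N \<omega>) ({0..s} \<times> {0..t})"

(* Independence of the fields is independence of the processes (s, t) \<mapsto> N_j(s, t), i.e. of random
   variables with values in the product of copies of the real line indexed by the quadrant. *)
definition independent_prfs ::
  "'w measure \<Rightarrow> real set \<Rightarrow> (real \<Rightarrow> real) \<Rightarrow> (real \<Rightarrow> 'w \<Rightarrow> (real \<times> real) measure) \<Rightarrow> bool" where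
  "independent_prfs M J lam N \<longleftrightarrow>
     (\<forall>j\<in>J. poisson_random_field M (N j) (lam j)) \<and>
     prob_space.indep_vars M (\<lambda>_. Pi\<^sub>M quadrant (\<lambda>_. borel))
       (\<lambda>j \<omega>. \<lambda>p\<in>quadrant. prf_at (N j) (fst p) (snd p) \<omega>) J"

definition generalized_skellam_field ::
  "'w measure \<Rightarrow> real set \<Rightarrow> (real \<Rightarrow> real) \<Rightarrow> (real \<Rightarrow> real \<Rightarrow> 'w \<Rightarrow> real) \<Rightarrow> bool" where
  "generalized_skellam_field M J lam S \<longleftrightarrow>
     (\<exists>N. independent_prfs M J lam N \<and>
       (\<forall>s\<ge>0. \<forall>t\<ge>0. \<forall>\<omega>\<in>space M. S s t \<omega> = (\<Sum>j\<in>J. j * prf_at (N j) s t \<omega>)))"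

end

theory Submission
  imports Defs
begin

text \<open>
  Exchanging the order of integration turns the integrated field into a linear functional of the
  random measures: every point \<open>(u, v)\<close> of \<open>N\<^sub>j\<close> in the rectangle
  \<open>K = [0, s] \<times> [0, t]\<close> is counted by \<open>N\<^sub>j(x, y)\<close> exactly for \<open>u \<le> x\<close> and \<open>v \<le> y\<close>, so
  \<open>\<integral>\<integral> N\<^sub>j(x, y) dy dx = \<integral>\<^sub>K (s - u) (t - v) dN\<^sub>j(u, v)\<close>. For a Poisson random measure the
  characteristic function of \<open>\<integral> g dN\<close> is \<open>exp (\<lambda> \<integral> (e\<^sup>i\<^sup>g - 1))\<close> (Campbell's formula),
  independence multiplies these over \<open>j\<close>, and the substitution
  \<open>u = s (1 - x)\<close>, \<open>v = t (1 - y)\<close> gives the right-hand side.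

  Independence is only given for the processes \<open>(x, y) \<mapsto> N\<^sub>j(x, y)\<close>, as elements of a product space
  over an uncountable index set, and the integral of a path is not a measurable functional there.
  Riemann sums are, since they read finitely many coordinates. So the formula is first proved for
  the Riemann sums. They are integrals \<open>\<integral>\<^sub>K f\<^sub>n dN\<^sub>j\<close> of step functions
  \<open>f\<^sub>n(u, v) \<rightarrow> (s - u) (t - v)\<close> (lemmas \<open>prf_riemann_sum_eq_integral\<close> and
  \<open>riemann_tail_tendsto\<close>), hence Campbell's formula is needed for step functions only, where
  it is a product over the level sets (\<open>expectation_cis_integral_step\<close>). Dominated convergence is
  then used three times: for each fixed \<open>\<omega>\<close> with respect to the finite measure \<open>N\<^sub>j(\<omega>)\<close> on \<open>K\<close>
  (\<open>prf_riemann_sum_tendsto\<close>), under the expectation, and in the exponent.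
\<close>

section \<open>Characteristic functions of Poisson counts\<close>

text \<open>
  The law is given by its probability mass function and not as \<open>poisson_pmf\<close>, so that the
  degenerate mean \<open>m = 0\<close> (a null set) is covered. The values are extended non-negative reals,
  as for a random measure evaluated at a set.
\<close>

lemma (in prob_space) expectation_cis_poisson:
  fixes X :: "'a \<Rightarrow> ennreal"
  assumes [measurable]: "random_variable borel X"
    and nat_valued: "\<And>\<omega>. \<omega> \<in> space M \<Longrightarrow> \<exists>n::nat. X \<omega> = of_nat n"
    and pmf: "\<And>n. prob {\<omega> \<in> space M. X \<omega> = of_nat n} = exp (- m) * m ^ n / fact n"
  shows "expectation (\<lambda>\<omega>. cis (c * enn2real (X \<omega>))) = exp (of_real m * (cis c - 1))"
proof -
  define A where "A n = {\<omega> \<in> space M. X \<omega> = of_nat n}" for n :: nat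
  have [measurable]: "A n \<in> events" for n
    unfolding A_def by measurable
  have m0: "0 \<le> m"
  proof -
    have "0 \<le> prob {\<omega> \<in> space M. X \<omega> = of_nat 1}" by simp
    then show ?thesis unfolding pmf by (simp add: zero_le_mult_iff)
  qed
  define f where "f n \<omega> = indicator (A n) \<omega> *\<^sub>R cis (c * real n)" for n \<omega>
  have f_eq: "f n \<omega> = (if n = k then cis (c * real k) else 0)"
    if "\<omega> \<in> space M" "X \<omega> = of_nat k" for n k \<omega>
    using that by (auto simp: f_def A_def indicator_def)
  have int_f: "integral\<^sup>L M (f n) = (of_real m * cis c) ^ n /\<^sub>R fact n * exp (- of_real m)" for n
  proof -
    have "integral\<^sup>L M (f n) = (exp (- m) * m ^ n / fact n) *\<^sub>R cis (c * real n)"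
      unfolding f_def by (subst integral_scaleR_left) (auto simp: pmf[folded A_def] integrable_indicator_iff less_top[symmetric])
    then show ?thesis
      by (simp add: Complex.DeMoivre scaleR_conv_of_real power_mult_distrib field_simps exp_of_real[symmetric])
  qed
  have norm_f: "(\<integral>\<omega>. norm (f n \<omega>) \<partial>M) = m ^ n /\<^sub>R fact n * exp (- m)" for n
    unfolding f_def by (simp add: pmf[folded A_def] field_simps)
  have "(\<lambda>n. integral\<^sup>L M (f n)) sums (\<integral>\<omega>. (\<Sum>n. f n \<omega>) \<partial>M)"
  proof (rule sums_integral)
    show "integrable M (f n)" for n
      unfolding f_def by (auto simp: integrable_indicator_iff less_top[symmetric])
    show "AE \<omega> in M. summable (\<lambda>n. norm (f n \<omega>))"
    proof (rule AE_I2)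
      fix \<omega> assume w: "\<omega> \<in> space M"
      then obtain k where "X \<omega> = of_nat k" using nat_valued by blast
      then show "summable (\<lambda>n. norm (f n \<omega>))"
        by (intro summable_finite[of "{k}"]) (auto simp: f_eq[OF w])
    qed
    show "summable (\<lambda>n. \<integral>\<omega>. norm (f n \<omega>) \<partial>M)"
      unfolding norm_f by (intro summable_mult2 sums_summable[OF exp_converges])
  qed
  also have "(\<integral>\<omega>. (\<Sum>n. f n \<omega>) \<partial>M) = expectation (\<lambda>\<omega>. cis (c * enn2real (X \<omega>)))"
  proof (rule Bochner_Integration.integral_cong)
    fix \<omega> assume w: "\<omega> \<in> space M"
    then obtain k where k: "X \<omega> = of_nat k" using nat_valued by blast
    have "(\<Sum>n. f n \<omega>) = (\<Sum>n\<in>{k}. f n \<omega>)"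
      by (intro suminf_finite) (auto simp: f_eq[OF w k])
    then show "(\<Sum>n. f n \<omega>) = cis (c * enn2real (X \<omega>))"
      by (simp add: f_eq[OF w k] k)
  qed simp
  finally have "(\<lambda>n. integral\<^sup>L M (f n)) sums expectation (\<lambda>\<omega>. cis (c * enn2real (X \<omega>)))" .
  moreover have "(\<lambda>n. integral\<^sup>L M (f n)) sums (exp (of_real m * cis c) * exp (- of_real m))"
    unfolding int_f by (intro sums_mult2 exp_converges)
  ultimately show ?thesis
    by (metis sums_unique2 exp_add[symmetric] right_diff_distrib mult.right_neutral diff_conv_add_uminus)
qed

section \<open>Campbell's formula for step functions\<close>

lemma (in finite_measure) integral_comp_finite_range:
  fixes h :: "'b \<Rightarrow> 'c::{banach, second_countable_topology}"
  assumes fin: "finite (g ` space M)"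
    and meas: "\<And>v. {x \<in> space M. g x = v} \<in> sets M"
  shows "(\<integral>x. h (g x) \<partial>M) = (\<Sum>v\<in>g ` space M. measure M {x \<in> space M. g x = v} *\<^sub>R h v)"
proof -
  have "(\<integral>x. h (g x) \<partial>M)
      = (\<integral>x. (\<Sum>v\<in>g ` space M. indicator {x \<in> space M. g x = v} x *\<^sub>R h v) \<partial>M)"
  proof (rule Bochner_Integration.integral_cong[OF refl])
    fix x assume x: "x \<in> space M"
    have "(\<Sum>v\<in>g ` space M. indicator {x \<in> space M. g x = v} x *\<^sub>R h v)
        = (\<Sum>v\<in>g ` space M. if v = g x then h v else 0)"
      using x by (intro sum.cong) (auto simp: indicator_def)
    also have "\<dots> = h (g x)"
      using x fin by (simp add: sum.delta)
    finally show "h (g x) = (\<Sum>v\<in>g ` space M. indicator {x \<in> space M. g x = v} x *\<^sub>R h v)" ..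
  qed
  also have "\<dots> = (\<Sum>v\<in>g ` space M. \<integral>x. indicator {x \<in> space M. g x = v} x *\<^sub>R h v \<partial>M)"
    using meas by (intro Bochner_Integration.integral_sum)
      (auto simp: integrable_indicator_iff less_top[symmetric])
  also have "\<dots> = (\<Sum>v\<in>g ` space M. measure M {x \<in> space M. g x = v} *\<^sub>R h v)"
    using meas by (intro sum.cong refl) (subst integral_scaleR_left; auto simp: integrable_indicator_iff less_top[symmetric])
  finally show ?thesis .
qed

lemma cis_sum: "finite A \<Longrightarrow> cis (\<Sum>i\<in>A. f i) = (\<Prod>i\<in>A. cis (f i))"
  by (induction A rule: finite_induct) (auto simp: cis_mult[symmetric])

lemma borel_measurable_cis [measurable]: "cis \<in> borel_measurable borel"
  by (intro borel_measurable_continuous_onI continuous_intros)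

context poisson_random_field
begin

lemma
  assumes w: "\<omega> \<in> space M" and R: "R \<in> sets borel" "R \<subseteq> quadrant"
  shows sets_N_restrict: "sets (restrict_space (N \<omega>) R) = sets (restrict_space borel R)"
    and space_N_restrict: "space (restrict_space (N \<omega>) R) = R"
    and measure_N_restrict: "A \<subseteq> R \<Longrightarrow> measure (restrict_space (N \<omega>) R) A = measure (N \<omega>) A"
    and finite_measure_N_restrict: "bounded R \<Longrightarrow> finite_measure (restrict_space (N \<omega>) R)"
proof -
  have sp: "space (N \<omega>) = quadrant"
    using sets_eq_imp_space_eq[OF sets_N[OF w]] by (simp add: space_restrict_space)
  have "sets (restrict_space (N \<omega>) R) = sets (restrict_space (restrict_space borel quadrant) R)"
    by (intro sets_restrict_space_cong sets_N w)
  also have "\<dots> = sets (restrict_space borel R)"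
    using R(2) by (simp add: sets_restrict_restrict_space Int_absorb1)
  finally show "sets (restrict_space (N \<omega>) R) = sets (restrict_space borel R)" .
  show sR: "space (restrict_space (N \<omega>) R) = R"
    using R(2) by (auto simp: space_restrict_space sp)
  have RN: "R \<inter> space (N \<omega>) \<in> sets (N \<omega>)"
    unfolding sp sets_N[OF w] using R by (auto simp: sets_restrict_space)
  show "measure (restrict_space (N \<omega>) R) A = measure (N \<omega>) A" if "A \<subseteq> R"
    using RN that by (rule measure_restrict_space)
  show "finite_measure (restrict_space (N \<omega>) R)" if b: "bounded R"
  proof
    obtain n :: nat where "emeasure (N \<omega>) R = of_nat n"
      using integer_valued[OF w R b] by blast
    then show "emeasure (restrict_space (N \<omega>) R) (space (restrict_space (N \<omega>) R)) \<noteq> \<infinity>"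
      unfolding sR by (subst emeasure_restrict_space[OF RN]) auto
  qed
qed

text \<open>
  On the finitely many level sets of \<open>g\<close> in \<open>R\<close> the counts are independent Poisson variables, and
  both \<open>\<integral> g dN\<close> and the integral in the exponent are finite sums over these level sets.
\<close>

lemma expectation_cis_integral_step:
  fixes g :: "real \<times> real \<Rightarrow> real"
  assumes R: "R \<in> sets borel" "R \<subseteq> quadrant" "bounded R"
    and g[measurable]: "g \<in> borel_measurable borel" and fin: "finite (g ` R)"
  shows "expectation (\<lambda>\<omega>. cis (\<integral>p. g p \<partial>restrict_space (N \<omega>) R))
       = exp (of_real rate * (LINT p:R|lborel. cis (g p) - 1))"
proof -
  note [measurable] = R(1)
  obtain v where v: "bij_betw v {..<card (g ` R)} (g ` R)"
    using ex_bij_betw_nat_finite[OF fin] by (auto simp: atLeast0LessThan)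
  define n where "n = card (g ` R)"
  define B where "B i = {p \<in> R. g p = v i}" for i
  have Bm: "B i \<in> sets borel" for i
    unfolding B_def by measurable
  have Bq: "B i \<subseteq> quadrant" and Bb: "bounded (B i)" for i
    using R bounded_subset[OF R(3)] by (auto simp: B_def)
  have fin_vol: "emeasure lborel (B i) < \<infinity>" for i
    using emeasure_bounded_finite[OF Bb] by simp
  \<comment> \<open>Used for the random measure with \<open>h = id\<close>, and for Lebesgue measure with \<open>h = cis - 1\<close>.\<close>
  have by_levels: "(\<integral>p. h (g p) \<partial>\<mu>) = (\<Sum>i<n. measure \<mu> (B i) *\<^sub>R h (v i))"
    if "finite_measure \<mu>" "space \<mu> = R" "sets \<mu> = sets (restrict_space borel R)"
    for h :: "real \<Rightarrow> 'z::{banach, second_countable_topology}" and \<mu>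
  proof -
    interpret \<mu>: finite_measure \<mu> by fact
    have "{p \<in> R. g p = c} \<in> sets \<mu>" for c
    proof -
      have "{p \<in> R. g p = c} \<in> sets borel" by measurable
      then show ?thesis unfolding that(3) by (auto simp: sets_restrict_space)
    qed
    then have "(\<integral>p. h (g p) \<partial>\<mu>) = (\<Sum>c\<in>g ` R. measure \<mu> {p \<in> R. g p = c} *\<^sub>R h c)"
      using \<mu>.integral_comp_finite_range[of g h] fin that(2) by simp
    also have "\<dots> = (\<Sum>i<n. measure \<mu> (B i) *\<^sub>R h (v i))"
      unfolding B_def n_def by (rule sum.reindex_bij_betw[OF v, symmetric])
    finally show ?thesis .
  qed
  have indep: "indep_vars (\<lambda>_. borel) (\<lambda>i \<omega>. emeasure (N \<omega>) (B i)) {..<n}"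
  proof (rule indep_N)
    show "disjoint_family_on B {..<n}"
      using bij_betw_imp_inj_on[OF v]
      by (auto simp: disjoint_family_on_def B_def n_def inj_on_def)
  qed (use Bm Bq in auto)
  have "expectation (\<lambda>\<omega>. cis (\<integral>p. g p \<partial>restrict_space (N \<omega>) R))
      = expectation (\<lambda>\<omega>. \<Prod>i<n. cis (v i * enn2real (emeasure (N \<omega>) (B i))))"
  proof (rule Bochner_Integration.integral_cong[OF refl])
    fix \<omega> assume w: "\<omega> \<in> space M"
    have "B i \<subseteq> R" for i by (auto simp: B_def)
    then have "(\<integral>p. g p \<partial>restrict_space (N \<omega>) R) = (\<Sum>i<n. v i * enn2real (emeasure (N \<omega>) (B i)))"
      using by_levels[of "restrict_space (N \<omega>) R" "\<lambda>x. x"] finite_measure_N_restrict[OF w R]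
        sets_N_restrict[OF w R(1,2)] space_N_restrict[OF w R(1,2)]
        measure_N_restrict[OF w R(1,2)]
      by (simp add: measure_def mult.commute)
    then show "cis (\<integral>p. g p \<partial>restrict_space (N \<omega>) R)
        = (\<Prod>i<n. cis (v i * enn2real (emeasure (N \<omega>) (B i))))"
      by (simp add: cis_sum)
  qed
  also have "\<dots> = (\<Prod>i<n. expectation (\<lambda>\<omega>. cis (v i * enn2real (emeasure (N \<omega>) (B i)))))"
  proof (rule indep_vars_lebesgue_integral)
    show "indep_vars (\<lambda>_. borel) (\<lambda>i \<omega>. cis (v i * enn2real (emeasure (N \<omega>) (B i)))) {..<n}"
      by (rule indep_vars_compose2[OF indep]) measurable
    show "integrable M (\<lambda>\<omega>. cis (v i * enn2real (emeasure (N \<omega>) (B i))))" for i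
      using measurable_N[OF Bm Bq] by (intro integrable_const_bound[of _ 1]) auto
  qed simp
  also have "\<dots> = (\<Prod>i<n. exp (of_real (rate * measure lborel (B i)) * (cis (v i) - 1)))"
  proof (rule prod.cong[OF refl])
    fix i
    show "expectation (\<lambda>\<omega>. cis (v i * enn2real (emeasure (N \<omega>) (B i))))
        = exp (of_real (rate * measure lborel (B i)) * (cis (v i) - 1))"
      by (rule expectation_cis_poisson)
        (use measurable_N[OF Bm Bq] integer_valued[OF _ Bm Bq Bb] poisson_N[OF Bm Bq fin_vol] in auto)
  qed
  also have "\<dots> = exp (of_real rate * (\<Sum>i<n. measure lborel (B i) *\<^sub>R (cis (v i) - 1)))"
    by (simp add: exp_sum[symmetric] sum_distrib_left scaleR_conv_of_real mult.assoc)
  also have "(\<Sum>i<n. measure lborel (B i) *\<^sub>R (cis (v i) - 1))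
      = (\<integral>p. cis (g p) - 1 \<partial>restrict_space lborel R)"
  proof -
    have "finite_measure (restrict_space lborel R)"
      by standard (use emeasure_bounded_finite[OF R(3)] in
        \<open>simp add: emeasure_restrict_space space_restrict_space\<close>)
    from by_levels[OF this, of "\<lambda>x. cis x - 1"] show ?thesis
      by (simp add: space_restrict_space measure_restrict_space B_def cong: sets_restrict_space_cong)
  qed
  also have "\<dots> = (LINT p:R|lborel. cis (g p) - 1)"
    by (simp add: integral_restrict_space set_lebesgue_integral_def)
  finally show ?thesis .
qed

end

section \<open>Riemann sums of the field as integrals of step functions\<close>

lemma set_integral_sum:
  fixes f :: "'i \<Rightarrow> 'a \<Rightarrow> 'b::{banach, second_countable_topology}"
  assumes "\<And>i. i \<in> I \<Longrightarrow> set_integrable M A (f i)"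
  shows "(LINT x:A|M. \<Sum>i\<in>I. f i x) = (\<Sum>i\<in>I. LINT x:A|M. f i x)"
  using assms unfolding set_lebesgue_integral_def set_integrable_def
  by (simp add: scaleR_sum_right)

text \<open>
  Fubini, as \<open>{x. \<phi> p \<le> x} \<inter> [0, s]\<close> has length \<open>s - \<phi> p\<close>. Applying this once with
  \<open>\<phi> = snd\<close> and once with \<open>\<phi> = fst\<close> evaluates the double integral of the distribution function
  of a measure on the plane; the integrability statement is what allows integrating a finite
  linear combination term by term.
\<close>

lemma integral_sublevel_sets:
  fixes \<phi> h :: "'p \<Rightarrow> real"
  assumes "finite_measure \<nu>"
    and [measurable]: "\<phi> \<in> borel_measurable \<nu>" "h \<in> borel_measurable \<nu>"
    and \<phi>: "\<And>p. p \<in> space \<nu> \<Longrightarrow> 0 \<le> \<phi> p \<and> \<phi> p \<le> s"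
    and h: "\<And>p. p \<in> space \<nu> \<Longrightarrow> \<bar>h p\<bar> \<le> C"
  shows "set_integrable lborel {0..s} (\<lambda>x. \<integral>p. (if \<phi> p \<le> x then h p else 0) \<partial>\<nu>)"
    and "(LINT x:{0..s}|lborel. \<integral>p. (if \<phi> p \<le> x then h p else 0) \<partial>\<nu>)
       = (\<integral>p. (s - \<phi> p) * h p \<partial>\<nu>)"
proof -
  interpret \<nu>: finite_measure \<nu> by fact
  interpret pair_sigma_finite lborel \<nu> ..
  define f where "f x p = indicator {0..s} x * (if \<phi> p \<le> x then h p else 0)" for x p
  have f_int: "integrable (lborel \<Otimes>\<^sub>M \<nu>) (\<lambda>(x, p). f x p)"
  proof (rule integrableI_bounded_set)
    show "{0..s} \<times> space \<nu> \<in> sets (lborel \<Otimes>\<^sub>M \<nu>)" by simp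
    show "(\<lambda>(x, p). f x p) \<in> borel_measurable (lborel \<Otimes>\<^sub>M \<nu>)"
      unfolding f_def by measurable
    show "emeasure (lborel \<Otimes>\<^sub>M \<nu>) ({0..s} \<times> space \<nu>) < \<infinity>"
      using \<nu>.emeasure_finite[of "space \<nu>"]
      by (subst \<nu>.emeasure_pair_measure_Times)
         (auto simp: emeasure_lborel_Icc_eq ennreal_mult_eq_top_iff less_top[symmetric])
    show "AE z in lborel \<Otimes>\<^sub>M \<nu>. z \<in> {0..s} \<times> space \<nu> \<longrightarrow> norm (case z of (x, p) \<Rightarrow> f x p) \<le> \<bar>C\<bar>"
      using h by (intro AE_I2) (force simp: f_def split: split_indicator)
    show "AE z in lborel \<Otimes>\<^sub>M \<nu>. z \<notin> {0..s} \<times> space \<nu> \<longrightarrow> (case z of (x, p) \<Rightarrow> f x p) = 0"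
      by (intro AE_I2) (auto simp: f_def space_pair_measure split: split_indicator_asm)
  qed
  have eq: "(\<integral>p. f x p \<partial>\<nu>) = indicator {0..s} x *\<^sub>R (\<integral>p. (if \<phi> p \<le> x then h p else 0) \<partial>\<nu>)" for x
    by (simp add: f_def)
  show "set_integrable lborel {0..s} (\<lambda>x. \<integral>p. (if \<phi> p \<le> x then h p else 0) \<partial>\<nu>)"
    using integrable_fst[OF f_int] unfolding eq set_integrable_def by simp
  have "(\<integral>p. (\<integral>x. f x p \<partial>lborel) \<partial>\<nu>) = (\<integral>x. (\<integral>p. f x p \<partial>\<nu>) \<partial>lborel)"
    by (rule Fubini_integral[OF f_int])
  also have "\<dots> = (LINT x:{0..s}|lborel. \<integral>p. (if \<phi> p \<le> x then h p else 0) \<partial>\<nu>)"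
    unfolding eq set_lebesgue_integral_def ..
  also have "(\<integral>p. (\<integral>x. f x p \<partial>lborel) \<partial>\<nu>) = (\<integral>p. (s - \<phi> p) * h p \<partial>\<nu>)"
  proof (rule Bochner_Integration.integral_cong[OF refl])
    fix p assume p: "p \<in> space \<nu>"
    have "(\<integral>x. f x p \<partial>lborel) = (\<integral>x. indicator {\<phi> p..s} x * h p \<partial>lborel)"
      using \<phi>[OF p] by (intro Bochner_Integration.integral_cong) (auto simp: f_def indicator_def)
    then show "(\<integral>x. f x p \<partial>lborel) = (s - \<phi> p) * h p"
      using \<phi>[OF p] by simp
  qed
  finally show "(LINT x:{0..s}|lborel. \<integral>p. (if \<phi> p \<le> x then h p else 0) \<partial>\<nu>)
       = (\<integral>p. (s - \<phi> p) * h p \<partial>\<nu>)" ..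
qed

text \<open>
  The left Riemann sum with \<open>n\<close> steps of the function \<open>x \<mapsto> indicator {0..x} u\<close> on \<open>[0, s]\<close>,
  whose integral is \<open>s - u\<close>.
\<close>

definition riemann_tail :: "real \<Rightarrow> nat \<Rightarrow> real \<Rightarrow> real" where
  "riemann_tail s n u = (\<Sum>k<n. s / n * indicator {0..s * k / n} u)"

lemma borel_measurable_riemann_tail [measurable]: "riemann_tail s n \<in> borel_measurable borel"
  unfolding riemann_tail_def by measurable

lemma riemann_tail_card:
  "riemann_tail s n u = s / n * card {k \<in> {..<n}. u \<in> {0..s * k / n}}"
proof -
  have "riemann_tail s n u = s / n * (\<Sum>k<n. if u \<in> {0..s * k / n} then 1 else 0)"
    unfolding riemann_tail_def sum_distrib_left by (intro sum.cong) auto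
  then show ?thesis by (simp add: sum.If_cases Int_def)
qed

lemma finite_range_riemann_tail: "finite (range (riemann_tail s n))"
proof (rule finite_subset)
  show "range (riemann_tail s n) \<subseteq> (\<lambda>m. s / n * real m) ` {..n}"
  proof
    fix y assume "y \<in> range (riemann_tail s n)"
    then obtain u where u: "y = riemann_tail s n u" by blast
    have "card {k \<in> {..<n}. u \<in> {0..s * k / n}} \<le> card {..<n}"
      by (intro card_mono) auto
    then show "y \<in> (\<lambda>m. s / n * real m) ` {..n}"
      unfolding u riemann_tail_card by auto
  qed
qed simp

lemma riemann_tail_bounds:
  assumes "0 \<le> s" shows "0 \<le> riemann_tail s n u" "riemann_tail s n u \<le> s"
proof -
  show "0 \<le> riemann_tail s n u"
    unfolding riemann_tail_def using assms by (intro sum_nonneg) auto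
  have "riemann_tail s n u \<le> (\<Sum>k<n. s / n)"
    unfolding riemann_tail_def using assms by (intro sum_mono) (auto simp: indicator_def)
  also have "\<dots> \<le> s" using assms by simp
  finally show "riemann_tail s n u \<le> s" .
qed

lemma riemann_tail_tendsto:
  assumes u: "0 \<le> u" "u \<le> s"
  shows "(\<lambda>n. riemann_tail s n u) \<longlonglongrightarrow> s - u"
proof (cases "s = 0")
  case True
  then show ?thesis using u by (simp add: riemann_tail_def)
next
  case False
  then have s: "s > 0" using u by simp
  have bound: "s - u - s / n \<le> riemann_tail s n u \<and> riemann_tail s n u \<le> s - u" if n: "n > 0" for n
  proof -
    define c where "c = n * u / s"
    have c: "0 \<le> c" "c \<le> n" using u s n by (auto simp: c_def field_simps)
    \<comment> \<open>The grid points to the right of \<open>u\<close> are those with index at least \<open>c\<close>; left endpoints make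
        their number \<open>n - \<lceil>c\<rceil>\<close>, without correction at \<open>u = 0\<close> or at \<open>u = s\<close>.\<close>
    have "{k \<in> {..<n}. u \<in> {0..s * k / n}} = {nat \<lceil>c\<rceil>..<n}"
    proof (intro set_eqI)
      fix k
      have "u \<le> s * k / n \<longleftrightarrow> c \<le> real k"
        using s n by (simp add: c_def field_simps)
      also have "\<dots> \<longleftrightarrow> nat \<lceil>c\<rceil> \<le> k" by linarith
      finally show "k \<in> {k \<in> {..<n}. u \<in> {0..s * k / n}} \<longleftrightarrow> k \<in> {nat \<lceil>c\<rceil>..<n}"
        using u by auto
    qed
    moreover have "nat \<lceil>c\<rceil> \<le> n" using c by linarith
    ultimately have eq: "riemann_tail s n u = s / n * (n - real (nat \<lceil>c\<rceil>))"
      unfolding riemann_tail_card by (simp add: of_nat_diff)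
    have "n - c - 1 \<le> n - real (nat \<lceil>c\<rceil>)" "n - real (nat \<lceil>c\<rceil>) \<le> n - c"
      using c by linarith+
    then have "s / n * (n - c - 1) \<le> riemann_tail s n u" "riemann_tail s n u \<le> s / n * (n - c)"
      unfolding eq using s by (intro mult_left_mono; simp)+
    moreover have "s / n * (n - c) = s - u" "s / n * (n - c - 1) = s - u - s / n"
      using s n by (simp_all add: c_def field_simps)
    ultimately show ?thesis by simp
  qed
  show ?thesis
  proof (rule tendsto_sandwich)
    show "\<forall>\<^sub>F n in sequentially. s - u - s / n \<le> riemann_tail s n u"
      "\<forall>\<^sub>F n in sequentially. riemann_tail s n u \<le> s - u"
      using eventually_gt_at_top[of 0] by (eventually_elim; use bound in blast)+
    show "(\<lambda>n. s - u - s / real n) \<longlonglongrightarrow> s - u"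
      using tendsto_diff[OF tendsto_const lim_const_over_n, of "s - u" s] by simp
  qed simp
qed

text \<open>
  A functional of an arbitrary \<open>F\<close>, so that it can be applied to a whole path of the
  field: it reads finitely many values of \<open>F\<close> and is therefore measurable on the product space.
\<close>

definition prf_riemann_sum ::
  "real \<Rightarrow> real \<Rightarrow> nat \<Rightarrow> (real \<times> real \<Rightarrow> real) \<Rightarrow> real" where
  "prf_riemann_sum s t n F = (\<Sum>k<n. \<Sum>l<n.
     s / real n * (t / real n) * F (s * real k / real n, t * real l / real n))"

context poisson_random_field
begin

context
  fixes s t :: real and K
  assumes st: "0 \<le> s" "0 \<le> t"
  defines "K \<equiv> {0..s} \<times> {0..t}"
begin

lemma rect: "K \<in> sets borel" "K \<subseteq> quadrant" "bounded K"
  unfolding K_def quadrant_def by (auto intro!: borel_closed closed_Times bounded_Times)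

text \<open>
  All four facts are about one fixed realisation, a finite measure on the rectangle. Sums and
  double integral are both integrals against this measure, with integrands
  \<open>f\<^sub>n(u, v)\<close> and \<open>(s - u) (t - v)\<close>, and the former converge pointwise to the latter, bounded by
  \<open>s * t\<close>.
\<close>

lemma
  assumes w: "\<omega> \<in> space M"
  shows prf_riemann_sum_eq_integral:
      "prf_riemann_sum s t n (\<lambda>p. prf_at N (fst p) (snd p) \<omega>)
      = (\<integral>p. riemann_tail s n (fst p) * riemann_tail t n (snd p) \<partial>restrict_space (N \<omega>) K)"
    and prf_riemann_sum_tendsto:
      "(\<lambda>n. prf_riemann_sum s t n (\<lambda>p. prf_at N (fst p) (snd p) \<omega>))
      \<longlonglongrightarrow> (LINT x:{0..s}|lborel. LINT y:{0..t}|lborel. prf_at N x y \<omega>)"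
    and prf_integrable_snd: "x \<in> {0..s} \<Longrightarrow> set_integrable lborel {0..t} (\<lambda>y. prf_at N x y \<omega>)"
    and prf_integrable_fst:
      "set_integrable lborel {0..s} (\<lambda>x. LINT y:{0..t}|lborel. prf_at N x y \<omega>)"
proof -
  define \<nu> where "\<nu> = restrict_space (N \<omega>) K"
  interpret \<nu>: finite_measure \<nu>
    unfolding \<nu>_def by (rule finite_measure_N_restrict[OF w rect])
  have sp: "space \<nu> = K"
    unfolding \<nu>_def by (rule space_N_restrict[OF w rect(1,2)])
  have sets\<nu>: "sets \<nu> = sets (restrict_space borel K)"
    unfolding \<nu>_def by (rule sets_N_restrict[OF w rect(1,2)])
  have meas: "q \<in> borel_measurable \<nu>" if "q \<in> borel_measurable (borel \<Otimes>\<^sub>M borel)"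
    for q :: "real \<times> real \<Rightarrow> real"
    using that unfolding measurable_cong_sets[OF sets\<nu> refl] borel_prod
    by (rule measurable_restrict_space1)
  have prf_eq: "prf_at N x y \<omega> = measure \<nu> ({0..x} \<times> {0..y})"
    if "x \<in> {0..s}" "y \<in> {0..t}" for x y
    unfolding prf_at_def \<nu>_def using that
    by (intro measure_N_restrict[OF w rect(1,2), symmetric]) (auto simp: K_def)
  have rect_sets: "{0..x} \<times> {0..y} \<in> sets \<nu>"
    if "x \<in> {0..s}" "y \<in> {0..t}" for x y
  proof -
    have "{0..x} \<times> {0..y} \<in> sets borel" by (intro borel_closed closed_Times) auto
    then show ?thesis using that rect(1) unfolding sets\<nu>
      by (subst sets_restrict_space_iff) (auto simp: K_def)
  qed
  have grid: "s * k / n \<in> {0..s}" "t * k / n \<in> {0..t}" if "k < n" for k n :: nat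
    using that st by (auto simp: field_simps mult_left_mono)
  show riem: "prf_riemann_sum s t n (\<lambda>p. prf_at N (fst p) (snd p) \<omega>)
      = (\<integral>p. riemann_tail s n (fst p) * riemann_tail t n (snd p) \<partial>restrict_space (N \<omega>) K)" for n
  proof -
    have "(\<integral>p. riemann_tail s n (fst p) * riemann_tail t n (snd p) \<partial>\<nu>)
        = (\<integral>p. (\<Sum>k<n. \<Sum>l<n. s / n * (t / n) * indicator ({0..s * k / n} \<times> {0..t * l / n}) p) \<partial>\<nu>)"
      unfolding riemann_tail_def sum_product
      by (intro Bochner_Integration.integral_cong sum.cong refl) (auto simp: indicator_def)
    also have "\<dots> = (\<Sum>k<n. \<Sum>l<n. \<integral>p. s / n * (t / n) * indicator ({0..s * k / n} \<times> {0..t * l / n}) p \<partial>\<nu>)"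
      by (subst Bochner_Integration.integral_sum; (intro sum.cong refl Bochner_Integration.integral_sum Bochner_Integration.integrable_sum)?)
         (use grid rect_sets in \<open>auto simp: integrable_indicator_iff less_top[symmetric]\<close>)
    also have "\<dots> = prf_riemann_sum s t n (\<lambda>p. prf_at N (fst p) (snd p) \<omega>)"
      unfolding prf_riemann_sum_def
      by (intro sum.cong refl) (use grid rect_sets in \<open>auto simp: prf_eq\<close>)
    finally show ?thesis unfolding \<nu>_def ..
  qed
  have lvl: "prf_at N x y \<omega> = (\<integral>p. (if snd p \<le> y then if fst p \<le> x then 1 else 0 else 0 :: real) \<partial>\<nu>)"
    if "x \<in> {0..s}" "y \<in> {0..t}" for x y
  proof -
    have "prf_at N x y \<omega> = (\<integral>p. indicator ({0..x} \<times> {0..y}) p \<partial>\<nu>)"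
      using that rect_sets[OF that, THEN sets.sets_into_space] by (simp add: prf_eq Int_absorb2)
    also have "\<dots> = (\<integral>p. (if snd p \<le> y then if fst p \<le> x then 1 else 0 else 0 :: real) \<partial>\<nu>)"
      by (intro Bochner_Integration.integral_cong) (auto simp: sp K_def indicator_def)
    finally show ?thesis .
  qed
  \<comment> \<open>Integrating out \<open>y\<close> leaves the weight \<open>t - snd p\<close>, which is then integrated along \<open>x\<close>.\<close>
  have snd_layer:
    "set_integrable lborel {0..t} (\<lambda>y. \<integral>p. (if snd p \<le> y then if fst p \<le> x then 1 else 0 else 0 :: real) \<partial>\<nu>)
    \<and> (LINT y:{0..t}|lborel. \<integral>p. (if snd p \<le> y then if fst p \<le> x then 1 else 0 else 0 :: real) \<partial>\<nu>)
       = (\<integral>p. (t - snd p) * (if fst p \<le> x then 1 else 0) \<partial>\<nu>)" for x :: real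
    by (intro conjI integral_sublevel_sets[OF \<nu>.finite_measure_axioms, where C=1] meas)
      (auto simp: sp K_def)
  have fst_layer:
    "set_integrable lborel {0..s} (\<lambda>x. \<integral>p. (if fst p \<le> x then t - snd p else 0) \<partial>\<nu>)
    \<and> (LINT x:{0..s}|lborel. \<integral>p. (if fst p \<le> x then t - snd p else 0) \<partial>\<nu>)
       = (\<integral>p. (s - fst p) * (t - snd p) \<partial>\<nu>)"
    by (intro conjI integral_sublevel_sets[OF \<nu>.finite_measure_axioms, where C=t] meas)
      (auto simp: sp K_def)
  show "set_integrable lborel {0..t} (\<lambda>y. prf_at N x y \<omega>)" if "x \<in> {0..s}" for x
    using snd_layer[of x, THEN conjunct1] by (rule set_integrable_cong[THEN iffD1, rotated -1]) (use that lvl in auto)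
  have inner: "(LINT y:{0..t}|lborel. prf_at N x y \<omega>) = (\<integral>p. (if fst p \<le> x then t - snd p else 0) \<partial>\<nu>)"
    if "x \<in> {0..s}" for x
  proof -
    have "(LINT y:{0..t}|lborel. prf_at N x y \<omega>)
        = (LINT y:{0..t}|lborel. \<integral>p. (if snd p \<le> y then if fst p \<le> x then 1 else 0 else 0 :: real) \<partial>\<nu>)"
      using that by (intro set_lebesgue_integral_cong) (auto simp: lvl)
    also have "\<dots> = (\<integral>p. (if fst p \<le> x then t - snd p else 0) \<partial>\<nu>)"
      unfolding snd_layer[THEN conjunct2] by (intro Bochner_Integration.integral_cong) auto
    finally show ?thesis .
  qed
  show "set_integrable lborel {0..s} (\<lambda>x. LINT y:{0..t}|lborel. prf_at N x y \<omega>)"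
    using fst_layer[THEN conjunct1] by (rule set_integrable_cong[THEN iffD1, rotated -1]) (use inner in auto)
  have total: "(LINT x:{0..s}|lborel. LINT y:{0..t}|lborel. prf_at N x y \<omega>)
      = (\<integral>p. (s - fst p) * (t - snd p) \<partial>\<nu>)"
    unfolding fst_layer[THEN conjunct2, symmetric] by (intro set_lebesgue_integral_cong) (auto simp: inner)
  show "(\<lambda>n. prf_riemann_sum s t n (\<lambda>p. prf_at N (fst p) (snd p) \<omega>))
      \<longlonglongrightarrow> (LINT x:{0..s}|lborel. LINT y:{0..t}|lborel. prf_at N x y \<omega>)"
    unfolding riem total \<nu>_def[symmetric]
  proof (rule integral_dominated_convergence[where w="\<lambda>_. s * t"])
    show "AE p in \<nu>. (\<lambda>n. riemann_tail s n (fst p) * riemann_tail t n (snd p))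
        \<longlonglongrightarrow> (s - fst p) * (t - snd p)"
      by (intro AE_I2 tendsto_mult riemann_tail_tendsto) (auto simp: sp K_def)
    show "AE p in \<nu>. norm (riemann_tail s n (fst p) * riemann_tail t n (snd p)) \<le> s * t" for n
      using riemann_tail_bounds st by (intro AE_I2) (auto simp: abs_mult intro!: mult_mono)
  qed ((intro meas; measurable) | simp)+
qed

lemma expectation_cis_prf_riemann_sum:
  "expectation (\<lambda>\<omega>. cis (c * prf_riemann_sum s t n (\<lambda>p. prf_at N (fst p) (snd p) \<omega>)))
   = exp (of_real rate *
       (LINT p:K|lborel. cis (c * (riemann_tail s n (fst p) * riemann_tail t n (snd p))) - 1))"
proof -
  let ?f = "\<lambda>p. c * (riemann_tail s n (fst p) * riemann_tail t n (snd p))"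
  have "?f ` K \<subseteq> (\<lambda>(a, b). c * (a * b)) ` (range (riemann_tail s n) \<times> range (riemann_tail t n))"
    by auto
  then have "finite (?f ` K)"
    by (rule finite_subset) (auto intro: finite_range_riemann_tail)
  moreover have "?f \<in> borel_measurable borel"
    unfolding borel_prod[symmetric] by measurable
  ultimately show ?thesis
    by (subst expectation_cis_integral_step[OF rect, symmetric])
       (auto intro!: Bochner_Integration.integral_cong simp: prf_riemann_sum_eq_integral)
qed

end
end

section \<open>Change of variables to the unit square\<close>

lemma set_integral_reflect_scale:
  fixes G :: "real \<Rightarrow> 'a::{banach, second_countable_topology}"
  assumes "0 \<le> s"
  shows "(LINT u:{0..s}|lborel. G (s - u)) = s *\<^sub>R (LINT x:{0..1}|lborel. G (s * x))"
proof (cases "s = 0")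
  case True
  have "AE x in lborel. x \<noteq> (0::real)" by (rule AE_lborel_singleton)
  then have "(LINT u:{0..s}|lborel. G (s - u)) = 0"
    unfolding set_lebesgue_integral_def using True by (intro integral_eq_zero_AE) auto
  then show ?thesis using True by simp
next
  case False
  then have "s > 0" using assms by simp
  then have "indicator {0..s} (s + - s * x) = (indicator {0..1} x :: real)" for x
    by (auto simp: indicator_def zero_le_mult_iff field_simps)
  then show ?thesis
    unfolding set_lebesgue_integral_def
    using \<open>s > 0\<close> by (subst lborel_integral_real_affine[of "- s" _ s]) (auto simp del: mult_minus_left)
qed

lemma integral_rectangle_reflect_scale:
  fixes G :: "real \<Rightarrow> complex"
  assumes st: "0 \<le> s" "0 \<le> t" and G[measurable]: "G \<in> borel_measurable borel" and C: "\<And>x. norm (G x) \<le> C"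
  shows "(LINT p:{0..s}\<times>{0..t}|lborel. G ((s - fst p) * (t - snd p)))
    = of_real (s * t) * (LINT y:{0..1}|lborel. LINT x:{0..1}|lborel. G (s * t * x * y))"
proof -
  let ?f = "\<lambda>p. indicator ({0..s}\<times>{0..t}) p *\<^sub>R G ((s - fst p) * (t - snd p))"
  have "integrable (lborel \<Otimes>\<^sub>M lborel) ?f"
  proof (rule integrableI_bounded_set[where A="{0..s}\<times>{0..t}" and B=C])
    show "emeasure (lborel \<Otimes>\<^sub>M lborel) ({0..s} \<times> {0..t}) < \<infinity>"
      using st by (subst lborel.emeasure_pair_measure_Times)
         (auto simp: ennreal_mult_less_top)
  qed (use C in auto)
  then have "(\<integral>p. ?f p \<partial>(lborel \<Otimes>\<^sub>M lborel)) = (\<integral>v. (\<integral>u. ?f (u, v) \<partial>lborel) \<partial>lborel)"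
    by (subst lborel_pair.integral_snd) (auto simp: case_prod_unfold)
  then have "(LINT p:{0..s}\<times>{0..t}|lborel. G ((s - fst p) * (t - snd p)))
      = (\<integral>v. (\<integral>u. ?f (u, v) \<partial>lborel) \<partial>lborel)"
    unfolding set_lebesgue_integral_def lborel_prod .
  also have "\<dots> = (LINT v:{0..t}|lborel. LINT u:{0..s}|lborel. G ((s - u) * (t - v)))"
    unfolding set_lebesgue_integral_def
    by (intro Bochner_Integration.integral_cong) (auto simp: indicator_def of_bool_def)
  also have "\<dots> = (LINT v:{0..t}|lborel. s *\<^sub>R (LINT x:{0..1}|lborel. G (s * x * (t - v))))"
    by (subst set_integral_reflect_scale[OF st(1), of "\<lambda>u. G (u * _)"]) simp
  also have "\<dots> = t *\<^sub>R (LINT y:{0..1}|lborel. s *\<^sub>R (LINT x:{0..1}|lborel. G (s * x * (t * y))))"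
    by (rule set_integral_reflect_scale[OF st(2)])
  finally show ?thesis
    by (simp add: scaleR_conv_of_real mult_ac)
qed

section \<open>The characteristic function of the integrated field\<close>

theorem proposition4p2:
  fixes M :: "'w measure" and J :: "real set" and lam :: "real \<Rightarrow> real"
    and S :: "real \<Rightarrow> real \<Rightarrow> 'w \<Rightarrow> real" and s t \<xi> :: real
  assumes "prob_space M"
    and "finite J" and "0 \<notin> J"
    and "\<And>j. j \<in> J \<Longrightarrow> lam j > 0"
    and "generalized_skellam_field M J lam S"
    and "s \<ge> 0" and "t \<ge> 0"
  shows "(LINT \<omega>|M. exp (\<i> * complex_of_real (\<xi> *
              (LINT x:{0..s}|lborel. LINT y:{0..t}|lborel. S x y \<omega>)))) =
         exp (\<Sum>j\<in>J. complex_of_real (lam j * s * t) *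
              (LINT y:{0..1}|lborel. LINT x:{0..1}|lborel.
                 exp (\<i> * complex_of_real (j * \<xi> * s * t * x * y)) - 1))"
proof -
  interpret prob_space M by fact
  note st = \<open>s \<ge> 0\<close> \<open>t \<ge> 0\<close>
  obtain N where prfs: "\<And>j. j \<in> J \<Longrightarrow> poisson_random_field M (N j) (lam j)"
    and indep: "indep_vars (\<lambda>_. Pi\<^sub>M quadrant (\<lambda>_. borel))
       (\<lambda>j \<omega>. \<lambda>p\<in>quadrant. prf_at (N j) (fst p) (snd p) \<omega>) J"
    and S: "\<And>x y \<omega>. 0 \<le> x \<Longrightarrow> 0 \<le> y \<Longrightarrow> \<omega> \<in> space M \<Longrightarrow>
      S x y \<omega> = (\<Sum>j\<in>J. j * prf_at (N j) x y \<omega>)"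
    using assms(5) unfolding generalized_skellam_field_def independent_prfs_def by blast
  define X where "X j \<omega> = (LINT x:{0..s}|lborel. LINT y:{0..t}|lborel. prf_at (N j) x y \<omega>)" for j \<omega>
  define Z where "Z n j \<omega> = prf_riemann_sum s t n (\<lambda>p. prf_at (N j) (fst p) (snd p) \<omega>)" for n j \<omega>
  define K where "K = {0..s} \<times> {0..t}"
  define f where "f n p = riemann_tail s n (fst p) * riemann_tail t n (snd p)" for n and p :: "real \<times> real"

  have S_integral: "(LINT x:{0..s}|lborel. LINT y:{0..t}|lborel. S x y \<omega>) = (\<Sum>j\<in>J. j * X j \<omega>)"
    if w: "\<omega> \<in> space M" for \<omega>
  proof -
    have inner: "(LINT y:{0..t}|lborel. S x y \<omega>) = (\<Sum>j\<in>J. j * (LINT y:{0..t}|lborel. prf_at (N j) x y \<omega>))"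
      if x: "x \<in> {0..s}" for x
    proof -
      have "(LINT y:{0..t}|lborel. S x y \<omega>) = (LINT y:{0..t}|lborel. \<Sum>j\<in>J. j * prf_at (N j) x y \<omega>)"
        using x w by (intro set_lebesgue_integral_cong) (auto simp: S)
      also have "\<dots> = (\<Sum>j\<in>J. LINT y:{0..t}|lborel. j * prf_at (N j) x y \<omega>)"
        using poisson_random_field.prf_integrable_snd[OF prfs st w x]
        by (intro set_integral_sum set_integrable_mult_right) auto
      finally show ?thesis by simp
    qed
    have "(LINT x:{0..s}|lborel. LINT y:{0..t}|lborel. S x y \<omega>)
        = (LINT x:{0..s}|lborel. \<Sum>j\<in>J. j * (LINT y:{0..t}|lborel. prf_at (N j) x y \<omega>))"
      by (intro set_lebesgue_integral_cong) (auto simp: inner)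
    also have "\<dots> = (\<Sum>j\<in>J. LINT x:{0..s}|lborel. j * (LINT y:{0..t}|lborel. prf_at (N j) x y \<omega>))"
      using poisson_random_field.prf_integrable_fst[OF prfs st w]
      by (intro set_integral_sum set_integrable_mult_right) auto
    finally show ?thesis unfolding X_def by simp
  qed

  have Z_lim: "(\<lambda>n. Z n j \<omega>) \<longlonglongrightarrow> X j \<omega>" if "j \<in> J" "\<omega> \<in> space M" for j \<omega>
    unfolding Z_def X_def by (rule poisson_random_field.prf_riemann_sum_tendsto[OF prfs st]) fact+

  \<comment> \<open>Every grid point lies in the quadrant, so the Riemann sum of the restricted path is the
      Riemann sum of the path.\<close>
  have Z_indep: "indep_vars (\<lambda>_. borel) (Z n) J" for n
  proof -
    have grid: "(s * k / n, t * l / n) \<in> quadrant" for k l :: nat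
      using st by (auto simp: quadrant_def)
    have "indep_vars (\<lambda>_. borel) (\<lambda>j \<omega>. prf_riemann_sum s t n
        (\<lambda>p\<in>quadrant. prf_at (N j) (fst p) (snd p) \<omega>)) J"
      by (rule indep_vars_compose2[OF indep]) (use grid in \<open>auto simp: prf_riemann_sum_def\<close>)
    then show ?thesis
      by (rule indep_vars_cong[THEN iffD1, rotated -1])
         (use grid in \<open>auto simp: Z_def prf_riemann_sum_def fun_eq_iff\<close>)
  qed
  have Z_meas[measurable]: "random_variable borel (Z n j)" if "j \<in> J" for n j
    using Z_indep that by (auto simp: indep_vars_def)
  have X_meas[measurable]: "random_variable borel (X j)" if "j \<in> J" for j
    by (rule borel_measurable_LIMSEQ_metric[where f="\<lambda>n. Z n j"]) (use that Z_lim in auto)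

  have step: "expectation (\<lambda>\<omega>. cis (\<xi> * (\<Sum>j\<in>J. j * Z n j \<omega>)))
      = exp (\<Sum>j\<in>J. of_real (lam j) * (LINT p:K|lborel. cis (\<xi> * j * f n p) - 1))" for n
  proof -
    have "expectation (\<lambda>\<omega>. cis (\<xi> * (\<Sum>j\<in>J. j * Z n j \<omega>)))
        = expectation (\<lambda>\<omega>. \<Prod>j\<in>J. cis (\<xi> * j * Z n j \<omega>))"
      by (simp add: sum_distrib_left cis_sum \<open>finite J\<close> mult.assoc)
    also have "\<dots> = (\<Prod>j\<in>J. expectation (\<lambda>\<omega>. cis (\<xi> * j * Z n j \<omega>)))"
    proof (rule indep_vars_lebesgue_integral[OF \<open>finite J\<close>])
      show "indep_vars (\<lambda>_. borel) (\<lambda>j \<omega>. cis (\<xi> * j * Z n j \<omega>)) J"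
        by (rule indep_vars_compose2[OF Z_indep]) measurable
      show "integrable M (\<lambda>\<omega>. cis (\<xi> * j * Z n j \<omega>))" if "j \<in> J" for j
        using Z_meas[OF that] by (intro integrable_const_bound[of _ 1]) auto
    qed
    also have "\<dots> = (\<Prod>j\<in>J. exp (of_real (lam j) * (LINT p:K|lborel. cis (\<xi> * j * f n p) - 1)))"
      unfolding Z_def f_def K_def
      by (intro prod.cong refl poisson_random_field.expectation_cis_prf_riemann_sum prfs st)
    finally show ?thesis by (simp add: exp_sum \<open>finite J\<close>)
  qed

  have "(\<lambda>n. expectation (\<lambda>\<omega>. cis (\<xi> * (\<Sum>j\<in>J. j * Z n j \<omega>))))
      \<longlonglongrightarrow> expectation (\<lambda>\<omega>. cis (\<xi> * (\<Sum>j\<in>J. j * X j \<omega>)))"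
  proof (rule integral_dominated_convergence[where w="\<lambda>_. 1"])
    show "AE \<omega> in M. (\<lambda>n. cis (\<xi> * (\<Sum>j\<in>J. j * Z n j \<omega>))) \<longlonglongrightarrow> cis (\<xi> * (\<Sum>j\<in>J. j * X j \<omega>))"
      by (intro AE_I2 isCont_tendsto_compose[of _ cis] tendsto_intros Z_lim continuous_intros) auto
  qed auto
  moreover have "(\<lambda>n. expectation (\<lambda>\<omega>. cis (\<xi> * (\<Sum>j\<in>J. j * Z n j \<omega>))))
      \<longlonglongrightarrow> exp (\<Sum>j\<in>J. of_real (lam j) *
            (LINT p:K|lborel. cis (\<xi> * j * ((s - fst p) * (t - snd p))) - 1))"
    unfolding step
  proof (intro tendsto_exp tendsto_sum tendsto_mult tendsto_const)
    fix j
    have [measurable]: "f n \<in> borel_measurable borel" for n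
      unfolding f_def borel_prod[symmetric] by measurable
    have [measurable]: "K \<in> sets borel" unfolding K_def by (intro borel_closed closed_Times) auto
    have [measurable]: "(\<lambda>p. (s - fst p) * (t - snd p)) \<in> borel_measurable borel"
      unfolding borel_prod[symmetric] by measurable
    have "bounded K" unfolding K_def by (intro bounded_Times) auto
    show "(\<lambda>n. LINT p:K|lborel. cis (\<xi> * j * f n p) - 1)
        \<longlonglongrightarrow> (LINT p:K|lborel. cis (\<xi> * j * ((s - fst p) * (t - snd p))) - 1)"
      unfolding set_lebesgue_integral_def
    proof (rule integral_dominated_convergence[where w="\<lambda>p. indicator K p *\<^sub>R 2"])
      show "integrable lborel (\<lambda>p. indicator K p *\<^sub>R (2::real))"
        using emeasure_bounded_finite[OF \<open>bounded K\<close>] by (auto simp: integrable_indicator_iff)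
      show "AE p in lborel. (\<lambda>n. indicator K p *\<^sub>R (cis (\<xi> * j * f n p) - 1))
          \<longlonglongrightarrow> indicator K p *\<^sub>R (cis (\<xi> * j * ((s - fst p) * (t - snd p))) - 1)"
      proof (rule AE_I2)
        fix p :: "real \<times> real"
        show "(\<lambda>n. indicator K p *\<^sub>R (cis (\<xi> * j * f n p) - 1))
          \<longlonglongrightarrow> indicator K p *\<^sub>R (cis (\<xi> * j * ((s - fst p) * (t - snd p))) - 1)"
        proof (cases "p \<in> K")
          case True
          then show ?thesis unfolding f_def
            by (intro tendsto_intros isCont_tendsto_compose[of _ cis] riemann_tail_tendsto continuous_intros)
               (auto simp: K_def)
        qed simp
      qed
      show "AE p in lborel. norm (indicator K p *\<^sub>R (cis (\<xi> * j * f n p) - 1)) \<le> indicator K p *\<^sub>R 2" for n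
        using norm_triangle_ineq4[of "cis _" 1] by (intro AE_I2) (auto simp: indicator_def)
    qed measurable
  qed
  ultimately have lim: "expectation (\<lambda>\<omega>. cis (\<xi> * (\<Sum>j\<in>J. j * X j \<omega>)))
      = exp (\<Sum>j\<in>J. of_real (lam j) *
            (LINT p:K|lborel. cis (\<xi> * j * ((s - fst p) * (t - snd p))) - 1))"
    by (rule LIMSEQ_unique)
  have rescale: "(LINT p:K|lborel. cis (\<xi> * j * ((s - fst p) * (t - snd p))) - 1)
      = of_real (s * t) * (LINT y:{0..1}|lborel. LINT x:{0..1}|lborel. cis (j * \<xi> * s * t * x * y) - 1)" for j
  proof -
    have "norm (cis (\<xi> * j * x) - 1) \<le> 2" for x
      using norm_triangle_ineq4[of "cis (\<xi> * j * x)" 1] by simp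
    then show ?thesis unfolding K_def
      by (subst integral_rectangle_reflect_scale[OF st, where G="\<lambda>x. cis (\<xi> * j * x) - 1"])
         (auto simp: mult_ac)
  qed
  have "(LINT \<omega>|M. exp (\<i> * complex_of_real (\<xi> *
              (LINT x:{0..s}|lborel. LINT y:{0..t}|lborel. S x y \<omega>))))
      = expectation (\<lambda>\<omega>. cis (\<xi> * (\<Sum>j\<in>J. j * X j \<omega>)))"
    by (intro Bochner_Integration.integral_cong) (simp_all add: S_integral cis_conv_exp)
  also note lim
  finally show ?thesis
    unfolding rescale by (simp add: cis_conv_exp mult.assoc)
qed

end
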